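(* Let $m\ge 0$ and $n\ge 1$ be integers, and let $R$ be a field of characteristic either zero or a prime $p>2\left\lceil \lfloor m/2\rfloor/n^2\right\rceil$. Let $E^m$ be the Grassmann algebra of rank $m$ over $R$. Then the ring $M_nE^m$ of $n\times n$ matrices over $E^m$ does not satisfy the Capelli identity of $x$-degree $k=n^2+2\lfloor m/2\rfloor$.
   Context: The Grassmann algebra of rank $m$ over $R$ is the $R$-algebra $E^m=R\langle v_1,\dots,v_m\rangle/(v_k^2,\ v_iv_j+v_jv_i\mid 1\le k\le m,\ 1\le i<j\le m)$. The Capelli polynomial $d_k$ is the polynomial in noncommuting variables $$d_k(x_1,\dots,x_k;y_0,\dots,y_k)=\sum_{\pi\in\mathfrak S_k}(-1)^\pi\, y_0x_{\pi(1)}y_1x_{\pi(2)}\cdots y_{k-1}x_{\pi(k)}y_k,$$ where $\mathfrak S_k$ is the symmetric group on $\{1,\dots,k\}$ and $(-1)^\pi$ is the sign of $\pi$. The Capelli identity of $x$-degree $k$ holds in (is satisfied by) a ring $\mathfrak A$ if $d_k(x_1,\dots,x_k;y_0,\dots,y_k)=0$ for all $x_1,\dots,x_k,y_0,\dots,y_k\in\mathfrak A$. *)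

theory Defs
  imports
    "HOL-Algebra.QuotRing"
    "HOL-Algebra.Multiplicative_Group"
    "HOL-Combinatorics.Permutations"
    "HOL-Computational_Algebra.Primes"
    "Jordan_Normal_Form.Matrix"
begin

hide_const (open) Multiset.mult

(* HOL-Algebra sets the order of an element of infinite order to 0, which is what
   characteristic zero requires. *)
definition ring_char :: "('a, 'b) ring_scheme \<Rightarrow> nat" where
  "ring_char R = group.ord (add_monoid R) \<one>\<^bsub>R\<^esub>"

(* The free associative unital R-algebra on the generators X.  A noncommutative polynomial is
   identified with its coefficient function on words over X; words not over X get coefficient 0. *)
definition free_algebra :: "('a, 'b) ring_scheme \<Rightarrow> 'g set \<Rightarrow> ('g list \<Rightarrow> 'a) ring" where
  "free_algebra R X =
    \<lparr>carrier = {f. range f \<subseteq> carrier R \<and> finite {w. f w \<noteq> \<zero>\<^bsub>R\<^esub>} \<and>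
                  {w. f w \<noteq> \<zero>\<^bsub>R\<^esub>} \<subseteq> lists X},
     mult = (\<lambda>f g w. \<Oplus>\<^bsub>R\<^esub>i\<in>{..length w}. f (take i w) \<otimes>\<^bsub>R\<^esub> g (drop i w)),
     one = (\<lambda>w. if w = [] then \<one>\<^bsub>R\<^esub> else \<zero>\<^bsub>R\<^esub>),
     zero = (\<lambda>w. \<zero>\<^bsub>R\<^esub>),
     add = (\<lambda>f g w. f w \<oplus>\<^bsub>R\<^esub> g w)\<rparr>"

definition free_gen :: "('a, 'b) ring_scheme \<Rightarrow> 'g \<Rightarrow> 'g list \<Rightarrow> 'a" where
  "free_gen R x = (\<lambda>w. if w = [x] then \<one>\<^bsub>R\<^esub> else \<zero>\<^bsub>R\<^esub>)"

definition grassmann_relations :: "('a, 'b) ring_scheme \<Rightarrow> nat \<Rightarrow> (nat list \<Rightarrow> 'a) set" where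
  "grassmann_relations R m =
    (let F = free_algebra R {1..m}; v = free_gen R in
      {v k \<otimes>\<^bsub>F\<^esub> v k |k. 1 \<le> k \<and> k \<le> m} \<union>
      {(v i \<otimes>\<^bsub>F\<^esub> v j) \<oplus>\<^bsub>F\<^esub> (v j \<otimes>\<^bsub>F\<^esub> v i) |i j. 1 \<le> i \<and> i < j \<and> j \<le> m})"

definition grassmann_algebra :: "('a, 'b) ring_scheme \<Rightarrow> nat \<Rightarrow> (nat list \<Rightarrow> 'a) set ring" where
  "grassmann_algebra R m =
    free_algebra R {1..m} Quot genideal (free_algebra R {1..m}) (grassmann_relations R m)"

(* The type of matrices is the one of Jordan_Normal_Form, but its type class based operations are
   not used, since the entries come from the carrier of an explicit ring. *)
definition matrix_ring :: "nat \<Rightarrow> ('a, 'b) ring_scheme \<Rightarrow> 'a mat ring" where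
  "matrix_ring n S =
    \<lparr>carrier = {A \<in> carrier_mat n n. elements_mat A \<subseteq> carrier S},
     mult = (\<lambda>A B. mat n n (\<lambda>(i, j). \<Oplus>\<^bsub>S\<^esub>l\<in>{..<n}. A $$ (i, l) \<otimes>\<^bsub>S\<^esub> B $$ (l, j))),
     one = mat n n (\<lambda>(i, j). if i = j then \<one>\<^bsub>S\<^esub> else \<zero>\<^bsub>S\<^esub>),
     zero = mat n n (\<lambda>(i, j). \<zero>\<^bsub>S\<^esub>),
     add = (\<lambda>A B. mat n n (\<lambda>(i, j). A $$ (i, j) \<oplus>\<^bsub>S\<^esub> B $$ (i, j)))\<rparr>"

(* y 0 * x 1 * y 1 * x 2 * ... * y (k - 1) * x k * y k *)
primrec alternating_product ::
  "('a, 'b) ring_scheme \<Rightarrow> nat \<Rightarrow> (nat \<Rightarrow> 'a) \<Rightarrow> (nat \<Rightarrow> 'a) \<Rightarrow> 'a" where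
  "alternating_product A 0 x y = y 0"
| "alternating_product A (Suc k) x y =
     alternating_product A k x y \<otimes>\<^bsub>A\<^esub> x (Suc k) \<otimes>\<^bsub>A\<^esub> y (Suc k)"

definition capelli :: "('a, 'b) ring_scheme \<Rightarrow> nat \<Rightarrow> (nat \<Rightarrow> 'a) \<Rightarrow> (nat \<Rightarrow> 'a) \<Rightarrow> 'a" where
  "capelli A k x y =
    (\<Oplus>\<^bsub>A\<^esub>p\<in>{p. p permutes {1..k}}. [sign p] \<cdot>\<^bsub>A\<^esub> alternating_product A k (x \<circ> p) y)"

definition satisfies_capelli :: "('a, 'b) ring_scheme \<Rightarrow> nat \<Rightarrow> bool" where
  "satisfies_capelli A k \<longleftrightarrow>
    (\<forall>x \<in> {1..k} \<rightarrow> carrier A. \<forall>y \<in> {0..k} \<rightarrow> carrier A. capelli A k x y = \<zero>\<^bsub>A\<^esub>)"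

end

theory Submission
  imports Defs
begin

text \<open>
  Write \<open>N = n\<^sup>2\<close>, \<open>h = \<lfloor>m/2\<rfloor>\<close> and distribute the generators \<open>v\<^sub>1, \<dots>, v\<^bsub>2h\<^esub>\<close> in consecutive pairs
  cyclically among the \<open>N\<close> matrix units, so that each matrix unit gets an even number, at most
  \<open>2\<lceil>h/N\<rceil>\<close>, of them.  The arguments \<open>x\<^sub>t\<close> are the matrix units themselves and their products with
  the assigned generators; the \<open>y\<^sub>t\<close> are matrix units chosen so that only those permutations
  contribute which respect the underlying matrix units.  Within a block, moving the argument without
  generator from one of the slots of a pair to the other changes the sign of the permutation but not
  the product of generators, so only the permutations survive that fix all arguments without
  generator.  All of these contribute \<open>v\<^sub>1 \<dots> v\<^bsub>2h\<^esub>\<close> with the same sign, hence the Capelli polynomial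
  takes the value \<open>\<Prod>\<^sub>b s\<^sub>b! v\<^sub>1 \<dots> v\<^bsub>2h\<^esub>\<close> in one matrix entry, with \<open>s\<^sub>b \<le> 2\<lceil>h/N\<rceil>\<close> the block sizes.
  That \<open>v\<^sub>1 \<dots> v\<^bsub>2h\<^esub> \<noteq> 0\<close> is witnessed by the linear functional \<open>f \<mapsto> \<Sum>\<^sub>\<sigma> sign \<sigma> \<cdot> f(\<sigma>(1) \<dots> \<sigma>(2h))\<close> on
  the free algebra, which vanishes on the ideal of relations.
\<close>

section \<open>Double sums, reindexing and alternating sums over permutations\<close>

lemma (in comm_monoid) finprod_Sigma:
  assumes "finite A" "\<And>a. a \<in> A \<Longrightarrow> finite (B a)"
    and "\<And>a b. a \<in> A \<Longrightarrow> b \<in> B a \<Longrightarrow> f a b \<in> carrier G"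
  shows "(\<Otimes>a\<in>A. \<Otimes>b\<in>B a. f a b) = (\<Otimes>q\<in>Sigma A B. case_prod f q)"
proof -
  have "(\<Otimes>q\<in>Sigma A B. case_prod f q) = (\<Otimes>q\<in>(\<Union>a\<in>A. Pair a ` B a). case_prod f q)"
    by (rule arg_cong[where f = "finprod G _"]) auto
  also have "\<dots> = (\<Otimes>a\<in>A. \<Otimes>q\<in>Pair a ` B a. case_prod f q)"
    by (rule finprod_UN_disjoint) (use assms in \<open>auto simp: pairwise_def disjnt_def\<close>)
  also have "\<dots> = (\<Otimes>a\<in>A. \<Otimes>b\<in>B a. f a b)"
  proof (rule finprod_cong')
    fix a assume a: "a \<in> A"
    then show "(\<Otimes>q\<in>Pair a ` B a. case_prod f q) = (\<Otimes>b\<in>B a. f a b)"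
      using assms by (subst finprod_reindex) (auto simp: inj_on_def)
  qed (use assms in auto)
  finally show ?thesis by simp
qed

lemma (in comm_monoid) finprod_reindex_bij_betw:
  assumes "bij_betw h A B" "f \<in> B \<rightarrow> carrier G"
  shows "(\<Otimes>a\<in>A. f (h a)) = (\<Otimes>b\<in>B. f b)"
  using finprod_reindex[of f h A] assms by (auto simp: bij_betw_def)

lemma (in comm_monoid) finprod_swap:
  assumes "finite A" "finite B"
    and "\<And>a b. a \<in> A \<Longrightarrow> b \<in> B \<Longrightarrow> f a b \<in> carrier G"
  shows "(\<Otimes>a\<in>A. \<Otimes>b\<in>B. f a b) = (\<Otimes>b\<in>B. \<Otimes>a\<in>A. f a b)"
proof -
  have "(\<Otimes>a\<in>A. \<Otimes>b\<in>B. f a b) = (\<Otimes>q\<in>A \<times> B. case_prod f q)"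
    by (rule finprod_Sigma) (use assms in auto)
  also have "\<dots> = (\<Otimes>q\<in>B \<times> A. case_prod f (prod.swap q))"
    by (rule finprod_reindex_bij_betw[symmetric])
       (use assms in \<open>auto intro!: bij_betwI[of _ _ _ prod.swap]\<close>)
  also have "\<dots> = (\<Otimes>q\<in>B \<times> A. case_prod (\<lambda>b a. f a b) q)"
    by (rule finprod_cong') (use assms in auto)
  also have "\<dots> = (\<Otimes>b\<in>B. \<Otimes>a\<in>A. f a b)"
    by (rule finprod_Sigma[symmetric]) (use assms in auto)
  finally show ?thesis .
qed

lemma (in abelian_group) add_pow_sign:
  "a \<in> carrier G \<Longrightarrow> [sign p] \<cdot> a = (if evenperm p then a else \<ominus> a)"
  by (auto simp: sign_def add.int_pow_neg)

text \<open>Composition with the transposition matches even permutations with odd ones, and matched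
  terms cancel. Cancelling in pairs, rather than showing that the sum equals its own negative, keeps
  the argument valid in the presence of 2-torsion.\<close>

lemma (in abelian_group) alternating_finsum_eq_zero:
  assumes "finite S" "a \<in> S" "b \<in> S" "a \<noteq> b"
    and T: "\<And>p. p permutes S \<Longrightarrow> T p \<in> carrier G"
    and inv: "\<And>p. p permutes S \<Longrightarrow> T (p \<circ> transpose a b) = T p"
  shows "(\<Oplus>p\<in>{p. p permutes S}. [sign p] \<cdot> T p) = \<zero>"
proof -
  define E where "E = {p. p permutes S \<and> evenperm p}"
  define O' where "O' = {p. p permutes S \<and> \<not> evenperm p}"
  have fin: "finite E" "finite O'" unfolding E_def O'_def 
    by (rule finite_subset[OF _ finite_permutations[OF \<open>finite S\<close>]]; auto)+
  have tr: "transpose a b permutes S" using assms by (simp add: permutes_swap_id)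
  have perm: "permutation p" if "p permutes S" for p
    using that \<open>finite S\<close> permutation_permutes by blast
  have ev: "evenperm (p \<circ> transpose a b) \<longleftrightarrow> \<not> evenperm p" if "p permutes S" for p
    using evenperm_comp[OF perm[OF that] perm[OF tr]] \<open>a \<noteq> b\<close> by (simp add: evenperm_swap)
  have bij: "bij_betw (\<lambda>p. p \<circ> transpose a b) E O'"
    by (rule bij_betwI[of _ _ _ "\<lambda>p. p \<circ> transpose a b"])
       (auto simp: E_def O'_def ev o_assoc[symmetric] intro!: permutes_compose[OF tr])
  have "(\<Oplus>p\<in>{p. p permutes S}. [sign p] \<cdot> T p) = (\<Oplus>p\<in>E \<union> O'. [sign p] \<cdot> T p)"
    by (rule arg_cong[where f = "finsum G _"]) (auto simp: E_def O'_def)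
  also have "\<dots> = (\<Oplus>p\<in>E. [sign p] \<cdot> T p) \<oplus> (\<Oplus>p\<in>O'. [sign p] \<cdot> T p)"
    by (rule finsum_Un_disjoint) (use fin T in \<open>auto simp: E_def O'_def\<close>)
  also have "(\<Oplus>p\<in>E. [sign p] \<cdot> T p) = (\<Oplus>p\<in>E. T p)"
    by (rule finsum_cong') (use T in \<open>auto simp: E_def add_pow_sign\<close>)
  also have "(\<Oplus>p\<in>O'. [sign p] \<cdot> T p) = (\<Oplus>p\<in>E. \<ominus> T p)"
    apply (subst add.finprod_reindex_bij_betw[OF bij, symmetric])
    subgoal using T by (auto simp: O'_def)
    by (rule finsum_cong') (use T in \<open>auto simp: E_def add_pow_sign ev inv permutes_compose[OF tr]\<close>)
  also have "(\<Oplus>p\<in>E. T p) \<oplus> (\<Oplus>p\<in>E. \<ominus> T p) = (\<Oplus>p\<in>E. T p \<oplus> \<ominus> T p)"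
    by (rule finsum_addf[symmetric]) (use T in \<open>auto simp: E_def\<close>)
  also have "\<dots> = (\<Oplus>p\<in>E. \<zero>)"
    by (rule finsum_cong') (use T in \<open>auto simp: E_def r_neg\<close>)
  finally show ?thesis by simp
qed

lemma upt_split_two:
  "j + 2 \<le> k \<Longrightarrow> [1..<Suc k] = [1..<Suc j] @ [Suc j, Suc (Suc j)] @ [j + 3..<Suc k]"
  using upt_add_eq_append[of 1 "Suc j" "k - j"]
  by (simp add: upt_conv_Cons eval_nat_numeral)

text \<open>Exchanging two neighbouring letters of a word is the elementary move both of the
  vanishing argument for the top coefficient and of the involution used in counting
  permutations.\<close>

lemma map_comp_transpose_adjacent:
  assumes "j + 2 \<le> k"
  shows "map (p \<circ> transpose (Suc j) (Suc (Suc j))) [1..<Suc k] =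
    map p [1..<Suc j] @ [p (Suc (Suc j)), p (Suc j)] @ map p [j + 3..<Suc k]"
  unfolding upt_split_two[OF assms] by (auto simp: transpose_def)

text \<open>Takes an additive map through the signed sum that defines the Capelli polynomial.
  Additivity suffices because each summand is a term or the negative of a term.\<close>

lemma abelian_group_hom_signed_finsum:
  assumes "abelian_group A" "abelian_group B" "finite P"
    and h: "\<And>a. a \<in> carrier A \<Longrightarrow> h a \<in> carrier B"
      "\<And>a b. a \<in> carrier A \<Longrightarrow> b \<in> carrier A \<Longrightarrow> h (a \<oplus>\<^bsub>A\<^esub> b) = h a \<oplus>\<^bsub>B\<^esub> h b"
    and f: "\<And>p. p \<in> P \<Longrightarrow> f p \<in> carrier A"
  shows "h (\<Oplus>\<^bsub>A\<^esub>p\<in>P. [sign p] \<cdot>\<^bsub>A\<^esub> f p) = (\<Oplus>\<^bsub>B\<^esub>p\<in>P. [sign p] \<cdot>\<^bsub>B\<^esub> h (f p))"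
proof -
  interpret A: abelian_group A by fact
  interpret B: abelian_group B by fact
  interpret h: group_hom "add_monoid A" "add_monoid B" h
    by unfold_locales (auto simp: hom_def h)
  have zero: "h \<zero>\<^bsub>A\<^esub> = \<zero>\<^bsub>B\<^esub>" using h.hom_one by simp
  have minus: "h (\<ominus>\<^bsub>A\<^esub> a) = \<ominus>\<^bsub>B\<^esub> h a" if "a \<in> carrier A" for a
    using h.hom_inv[of a] that by (simp add: a_inv_def)
  have sgn: "h ([sign p] \<cdot>\<^bsub>A\<^esub> a) = [sign p] \<cdot>\<^bsub>B\<^esub> h a" if "a \<in> carrier A" for p a
    using that by (simp add: A.add_pow_sign B.add_pow_sign minus h)
  from \<open>finite P\<close> f show ?thesis
  proof (induction P)
    case empty
    then show ?case by (simp add: zero)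
  next
    case (insert p P)
    have "(\<Oplus>\<^bsub>A\<^esub>p\<in>P. [sign p] \<cdot>\<^bsub>A\<^esub> f p) \<in> carrier A"
      by (intro A.finsum_closed Pi_I A.add.int_pow_closed) (use insert in auto)
    with insert show ?case
      by (subst A.finsum_insert B.finsum_insert; simp add: h sgn Pi_def)+
  qed
qed

context abelian_group
begin

lemma add_pow_sign_finsum:
  assumes "finite I" "\<And>i. i \<in> I \<Longrightarrow> g i \<in> carrier G"
  shows "[sign p] \<cdot> (\<Oplus>i\<in>I. g i) = (\<Oplus>i\<in>I. [sign p] \<cdot> g i)"
  using assms by (induction I) (simp_all add: Pi_def add.int_pow_mult_distrib a_comm)

lemma alternating_finsum_swap:
  assumes "finite P" "finite I" "\<And>i p. i \<in> I \<Longrightarrow> p \<in> P \<Longrightarrow> g i p \<in> carrier G"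
  shows "(\<Oplus>p\<in>P. [sign p] \<cdot> (\<Oplus>i\<in>I. g i p)) = (\<Oplus>i\<in>I. \<Oplus>p\<in>P. [sign p] \<cdot> g i p)"
proof -
  have "(\<Oplus>p\<in>P. [sign p] \<cdot> (\<Oplus>i\<in>I. g i p)) = (\<Oplus>p\<in>P. \<Oplus>i\<in>I. [sign p] \<cdot> g i p)"
    by (rule finsum_cong') (use assms in \<open>auto simp: add_pow_sign_finsum intro!: finsum_closed\<close>)
  also have "\<dots> = (\<Oplus>i\<in>I. \<Oplus>p\<in>P. [sign p] \<cdot> g i p)"
    by (rule add.finprod_swap) (use assms in auto)
  finally show ?thesis .
qed

lemma add_pow_zero: "[(0::int)] \<cdot> a = \<zero>"
  by (simp add: add_pow_def)

lemma finsum_int_pow: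
  assumes "finite P" "a \<in> carrier G"
  shows "(\<Oplus>p\<in>P. [z p] \<cdot> a) = [(\<Sum>p\<in>P. z p :: int)] \<cdot> a"
  using assms by (induction P) (simp_all add: add.int_pow_mult add_pow_zero)

end

section \<open>The free algebra\<close>

lemma carrier_free_algebra:
  "f \<in> carrier (free_algebra R X) \<longleftrightarrow> (\<forall>w. f w \<in> carrier R) \<and> finite {w. f w \<noteq> \<zero>\<^bsub>R\<^esub>} \<and>
     (\<forall>w. f w \<noteq> \<zero>\<^bsub>R\<^esub> \<longrightarrow> w \<in> lists X)"
  by (auto simp: free_algebra_def)

lemma mult_free_algebra:
  "(f \<otimes>\<^bsub>free_algebra R X\<^esub> g) w = (\<Oplus>\<^bsub>R\<^esub>i\<in>{..length w}. f (take i w) \<otimes>\<^bsub>R\<^esub> g (drop i w))"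
  by (simp add: free_algebra_def)

lemma add_free_algebra: "(f \<oplus>\<^bsub>free_algebra R X\<^esub> g) w = f w \<oplus>\<^bsub>R\<^esub> g w"
  by (simp add: free_algebra_def)

lemma one_free_algebra: "\<one>\<^bsub>free_algebra R X\<^esub> w = (if w = [] then \<one>\<^bsub>R\<^esub> else \<zero>\<^bsub>R\<^esub>)"
  by (simp add: free_algebra_def)

lemma zero_free_algebra: "\<zero>\<^bsub>free_algebra R X\<^esub> w = \<zero>\<^bsub>R\<^esub>"
  by (simp add: free_algebra_def)

lemmas free_algebra_simps =
  mult_free_algebra add_free_algebra one_free_algebra zero_free_algebra

definition monomial :: "('a, 'b) ring_scheme \<Rightarrow> 'g list \<Rightarrow> 'g list \<Rightarrow> 'a" where
  "monomial R u = (\<lambda>w. if w = u then \<one>\<^bsub>R\<^esub> else \<zero>\<^bsub>R\<^esub>)"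

context cring
begin

lemma free_algebra_coeff_closed:
  "f \<in> carrier (free_algebra R X) \<Longrightarrow> f w \<in> carrier R"
  by (simp add: carrier_free_algebra)

lemma free_algebra_add_closed:
  assumes "f \<in> carrier (free_algebra R X)" "g \<in> carrier (free_algebra R X)"
  shows "f \<oplus>\<^bsub>free_algebra R X\<^esub> g \<in> carrier (free_algebra R X)"
proof -
  have "{w. f w \<oplus> g w \<noteq> \<zero>} \<subseteq> {w. f w \<noteq> \<zero>} \<union> {w. g w \<noteq> \<zero>}"
    by auto
  moreover from this have "finite {w. f w \<oplus> g w \<noteq> \<zero>}"
    by (rule finite_subset) (use assms in \<open>auto simp: carrier_free_algebra\<close>)
  ultimately show ?thesis
    using assms unfolding carrier_free_algebra add_free_algebra by blast
qed

lemma free_algebra_zero_closed: "\<zero>\<^bsub>free_algebra R X\<^esub> \<in> carrier (free_algebra R X)"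
  by (simp add: carrier_free_algebra zero_free_algebra)

text \<open>A word in the support of a product is a concatenation of words from the two supports;
  this gives finiteness as well as letters in \<open>X\<close>.\<close>

lemma free_algebra_mult_closed:
  assumes f: "f \<in> carrier (free_algebra R X)" and g: "g \<in> carrier (free_algebra R X)"
  shows "f \<otimes>\<^bsub>free_algebra R X\<^esub> g \<in> carrier (free_algebra R X)"
proof -
  let ?h = "f \<otimes>\<^bsub>free_algebra R X\<^esub> g"
  note [simp] = f[THEN free_algebra_coeff_closed] g[THEN free_algebra_coeff_closed]
  have sub: "{w. ?h w \<noteq> \<zero>} \<subseteq> (\<lambda>(u, v). u @ v) ` ({w. f w \<noteq> \<zero>} \<times> {w. g w \<noteq> \<zero>})"
  proof
    fix w assume "w \<in> {w. ?h w \<noteq> \<zero>}"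
    then have "(\<Oplus>i\<in>{..length w}. f (take i w) \<otimes> g (drop i w)) \<noteq> \<zero>"
      by (simp add: mult_free_algebra)
    then obtain i where "f (take i w) \<otimes> g (drop i w) \<noteq> \<zero>"
      using add.finprod_one_eqI[of "{..length w}" "\<lambda>i. f (take i w) \<otimes> g (drop i w)"] by blast
    then have "f (take i w) \<noteq> \<zero>" "g (drop i w) \<noteq> \<zero>"
      by auto
    then show "w \<in> (\<lambda>(u, v). u @ v) ` ({w. f w \<noteq> \<zero>} \<times> {w. g w \<noteq> \<zero>})"
      by (intro image_eqI[of _ _ "(take i w, drop i w)"]) auto
  qed
  have "finite {w. ?h w \<noteq> \<zero>}"
    by (rule finite_subset[OF sub], intro finite_imageI finite_cartesian_product)
       (use f g in \<open>simp_all add: carrier_free_algebra\<close>)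
  moreover have "w \<in> lists X" if "?h w \<noteq> \<zero>" for w
  proof -
    have "w \<in> {w. ?h w \<noteq> \<zero>}" using that by simp
    from subsetD[OF sub this] obtain u v where "w = u @ v" "f u \<noteq> \<zero>" "g v \<noteq> \<zero>"
      by auto
    moreover from this have "u \<in> lists X" "v \<in> lists X"
      using f g by (simp_all add: carrier_free_algebra)
    ultimately show ?thesis by simp
  qed
  moreover have "?h w \<in> carrier R" for w
    by (auto simp: mult_free_algebra)
  ultimately show ?thesis by (simp add: carrier_free_algebra)
qed

lemma monomial_closed: "set u \<subseteq> X \<Longrightarrow> monomial R u \<in> carrier (free_algebra R X)"
  by (auto simp: carrier_free_algebra monomial_def split: if_splits)

lemma free_algebra_abelian_group: "abelian_group (free_algebra R X)"
proof (rule abelian_groupI)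
  fix f g h assume fgh: "f \<in> carrier (free_algebra R X)" "g \<in> carrier (free_algebra R X)"
    "h \<in> carrier (free_algebra R X)"
  note [simp] = fgh[THEN free_algebra_coeff_closed]
  show "f \<oplus>\<^bsub>free_algebra R X\<^esub> g \<in> carrier (free_algebra R X)"
    using fgh by (intro free_algebra_add_closed)
  show "f \<oplus>\<^bsub>free_algebra R X\<^esub> g \<oplus>\<^bsub>free_algebra R X\<^esub> h =
      f \<oplus>\<^bsub>free_algebra R X\<^esub> (g \<oplus>\<^bsub>free_algebra R X\<^esub> h)"
    by (rule ext) (simp add: add_free_algebra a_assoc)
  show "f \<oplus>\<^bsub>free_algebra R X\<^esub> g = g \<oplus>\<^bsub>free_algebra R X\<^esub> f"
    by (rule ext) (simp add: add_free_algebra a_comm)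
  show "\<zero>\<^bsub>free_algebra R X\<^esub> \<oplus>\<^bsub>free_algebra R X\<^esub> f = f"
    by (rule ext) (simp add: free_algebra_simps)
  have "\<ominus> f w = \<zero> \<longleftrightarrow> f w = \<zero>" for w
    by (rule add.inv_eq_1_iff) simp
  then have "(\<lambda>w. \<ominus> f w) \<in> carrier (free_algebra R X)"
    using fgh(1) by (simp add: carrier_free_algebra)
  moreover have "(\<lambda>w. \<ominus> f w) \<oplus>\<^bsub>free_algebra R X\<^esub> f = \<zero>\<^bsub>free_algebra R X\<^esub>"
    by (rule ext) (simp add: free_algebra_simps l_neg)
  ultimately show "\<exists>g\<in>carrier (free_algebra R X). g \<oplus>\<^bsub>free_algebra R X\<^esub> f = \<zero>\<^bsub>free_algebra R X\<^esub>"
    by blast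
qed (rule free_algebra_zero_closed)

text \<open>Both sides sum over the ways to cut \<open>w\<close> into three consecutive pieces. The
  left side lists a cut by the end of the second piece and the end of the first, the right side by
  the lengths of the first two pieces.\<close>

lemma free_algebra_mult_assoc:
  assumes f: "f \<in> carrier (free_algebra R X)" and g: "g \<in> carrier (free_algebra R X)"
    and h: "h \<in> carrier (free_algebra R X)"
  shows "f \<otimes>\<^bsub>free_algebra R X\<^esub> g \<otimes>\<^bsub>free_algebra R X\<^esub> h =
    f \<otimes>\<^bsub>free_algebra R X\<^esub> (g \<otimes>\<^bsub>free_algebra R X\<^esub> h)"
proof
  fix w :: "'c list"
  let ?n = "length w"
  note [simp] = f[THEN free_algebra_coeff_closed] g[THEN free_algebra_coeff_closed]
    h[THEN free_algebra_coeff_closed]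
  \<comment> \<open>\<open>T j l\<close> belongs to the cut whose first two pieces have lengths
    \<open>j\<close> and \<open>l\<close>.\<close>
  define T where "T = (\<lambda>j l. f (take j w) \<otimes> (g (take l (drop j w)) \<otimes> h (drop l (drop j w))))"
  have Tc: "T j l \<in> carrier R" for j l
    by (simp add: T_def)
  have "(f \<otimes>\<^bsub>free_algebra R X\<^esub> g \<otimes>\<^bsub>free_algebra R X\<^esub> h) w =
      (\<Oplus>i\<in>{..?n}. \<Oplus>j\<in>{..i}. T j (i - j))"
    unfolding mult_free_algebra
  proof (rule finsum_cong')
    show "(\<lambda>i. \<Oplus>j\<in>{..i}. T j (i - j)) \<in> {..?n} \<rightarrow> carrier R"
      by (intro Pi_I finsum_closed Tc)
  next
    fix i assume i: "i \<in> {..?n}"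
    have "(\<Oplus>j\<in>{..length (take i w)}. f (take j (take i w)) \<otimes> g (drop j (take i w))) \<otimes> h (drop i w)
      = (\<Oplus>j\<in>{..i}. f (take j (take i w)) \<otimes> g (drop j (take i w))) \<otimes> h (drop i w)"
      using i by (simp add: min_def)
    also have "\<dots> = (\<Oplus>j\<in>{..i}. f (take j (take i w)) \<otimes> g (drop j (take i w)) \<otimes> h (drop i w))"
      by (rule finsum_ldistr) auto
    also have "\<dots> = (\<Oplus>j\<in>{..i}. T j (i - j))"
      by (rule finsum_cong') (auto simp: T_def m_assoc min_def drop_take)
    finally show "(\<Oplus>j\<in>{..length (take i w)}. f (take j (take i w)) \<otimes> g (drop j (take i w)))
      \<otimes> h (drop i w) = (\<Oplus>j\<in>{..i}. T j (i - j))" .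
  qed (rule refl)
  also have "\<dots> = (\<Oplus>q\<in>(SIGMA i:{..?n}. {..i}). case_prod (\<lambda>i j. T j (i - j)) q)"
    by (subst add.finprod_Sigma[of _ "\<lambda>i. {..i}"]) (simp_all add: Tc)
  also have "\<dots> = (\<Oplus>q\<in>(SIGMA i:{..?n}. {..i}).
      case_prod T (case q of (i, j) \<Rightarrow> (j, i - j)))"
    by (rule finsum_cong') (auto simp: T_def)
  also have "\<dots> = (\<Oplus>q\<in>(SIGMA j:{..?n}. {..?n - j}). case_prod T q)"
    by (rule add.finprod_reindex_bij_betw, rule bij_betwI[of _ _ _ "\<lambda>(j, l). (j + l, j)"])
       (auto simp: T_def)
  also have "\<dots> = (\<Oplus>j\<in>{..?n}. \<Oplus>l\<in>{..?n - j}. T j l)"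
    by (subst add.finprod_Sigma[of _ "\<lambda>j. {..?n - j}"]) (simp_all add: Tc)
  also have "\<dots> = (f \<otimes>\<^bsub>free_algebra R X\<^esub> (g \<otimes>\<^bsub>free_algebra R X\<^esub> h)) w"
    unfolding mult_free_algebra
    by (rule finsum_cong') (auto simp: T_def finsum_rdistr)
  finally show "(f \<otimes>\<^bsub>free_algebra R X\<^esub> g \<otimes>\<^bsub>free_algebra R X\<^esub> h) w =
    (f \<otimes>\<^bsub>free_algebra R X\<^esub> (g \<otimes>\<^bsub>free_algebra R X\<^esub> h)) w" .
qed

text \<open>Only the cut of \<open>w\<close> at position \<open>length u\<close> can contribute; if
  \<open>w\<close> is shorter than \<open>u\<close>, no such cut exists and both sides
  vanish.\<close>

lemma monomial_mult:
  "monomial R u \<otimes>\<^bsub>free_algebra R X\<^esub> monomial R v = monomial R (u @ v)"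
proof
  fix w
  have "(monomial R u \<otimes>\<^bsub>free_algebra R X\<^esub> monomial R v) w =
      (\<Oplus>i\<in>{..length w}. if length u = i then (if w = u @ v then \<one> else \<zero>) else \<zero>)"
    unfolding mult_free_algebra
  proof (rule finsum_cong')
    fix i assume "i \<in> {..length w}"
    then have "take i w = u \<and> drop i w = v \<longleftrightarrow> length u = i \<and> w = u @ v"
      by (auto simp: append_eq_conv_conj)
    then show "monomial R u (take i w) \<otimes> monomial R v (drop i w) =
        (if length u = i then (if w = u @ v then \<one> else \<zero>) else \<zero>)"
      by (auto simp: monomial_def)
  qed auto
  also have "\<dots> = monomial R (u @ v) w"
  proof (cases "length u \<le> length w")
    case True
    then show ?thesis
      using finsum_singleton[of "length u" "{..length w}" "\<lambda>_. if w = u @ v then \<one> else \<zero>"]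
      by (simp add: monomial_def)
  next
    case False
    then have "(\<Oplus>i\<in>{..length w}. if length u = i then (if w = u @ v then \<one> else \<zero>) else \<zero>) = \<zero>"
      by (intro add.finprod_one_eqI) auto
    with False show ?thesis by (auto simp: monomial_def)
  qed
  finally show "(monomial R u \<otimes>\<^bsub>free_algebra R X\<^esub> monomial R v) w = monomial R (u @ v) w" .
qed

lemma one_free_algebra_eq: "\<one>\<^bsub>free_algebra R X\<^esub> = monomial R []"
  by (simp add: fun_eq_iff one_free_algebra monomial_def)

lemma free_algebra_one_closed: "\<one>\<^bsub>free_algebra R X\<^esub> \<in> carrier (free_algebra R X)"
  by (simp add: one_free_algebra_eq monomial_closed)

lemma free_gen_eq: "free_gen R x = monomial R [x]"
  by (simp add: free_gen_def monomial_def)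

lemma free_algebra_one_mult:
  assumes "f \<in> carrier (free_algebra R X)"
  shows "\<one>\<^bsub>free_algebra R X\<^esub> \<otimes>\<^bsub>free_algebra R X\<^esub> f = f"
proof
  fix w
  note [simp] = assms[THEN free_algebra_coeff_closed]
  have "(\<one>\<^bsub>free_algebra R X\<^esub> \<otimes>\<^bsub>free_algebra R X\<^esub> f) w =
      (\<Oplus>i\<in>{..length w}. if 0 = i then f (drop i w) else \<zero>)"
    unfolding mult_free_algebra
    by (rule finsum_cong') (auto simp: one_free_algebra)
  also have "\<dots> = f w"
    using finsum_singleton[of 0 "{..length w}" "\<lambda>i. f (drop i w)"] by simp
  finally show "(\<one>\<^bsub>free_algebra R X\<^esub> \<otimes>\<^bsub>free_algebra R X\<^esub> f) w = f w" .
qed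

lemma free_algebra_mult_one:
  assumes "f \<in> carrier (free_algebra R X)"
  shows "f \<otimes>\<^bsub>free_algebra R X\<^esub> \<one>\<^bsub>free_algebra R X\<^esub> = f"
proof
  fix w
  note [simp] = assms[THEN free_algebra_coeff_closed]
  have "(f \<otimes>\<^bsub>free_algebra R X\<^esub> \<one>\<^bsub>free_algebra R X\<^esub>) w =
      (\<Oplus>i\<in>{..length w}. if length w = i then f (take i w) else \<zero>)"
    unfolding mult_free_algebra
    by (rule finsum_cong') (auto simp: one_free_algebra)
  also have "\<dots> = f w"
    using finsum_singleton[of "length w" "{..length w}" "\<lambda>i. f (take i w)"] by simp
  finally show "(f \<otimes>\<^bsub>free_algebra R X\<^esub> \<one>\<^bsub>free_algebra R X\<^esub>) w = f w" .
qed

lemma free_algebra_ring: "ring (free_algebra R X)"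
proof (rule ringI)
  show "abelian_group (free_algebra R X)"
    by (rule free_algebra_abelian_group)
  show "Group.monoid (free_algebra R X)"
    by (rule monoidI)
       (auto simp: free_algebra_mult_closed free_algebra_mult_assoc free_algebra_one_mult
         free_algebra_mult_one free_algebra_one_closed)
  fix f g h assume fgh: "f \<in> carrier (free_algebra R X)" "g \<in> carrier (free_algebra R X)"
    "h \<in> carrier (free_algebra R X)"
  note [simp] = fgh[THEN free_algebra_coeff_closed]
  show "(f \<oplus>\<^bsub>free_algebra R X\<^esub> g) \<otimes>\<^bsub>free_algebra R X\<^esub> h =
      f \<otimes>\<^bsub>free_algebra R X\<^esub> h \<oplus>\<^bsub>free_algebra R X\<^esub> g \<otimes>\<^bsub>free_algebra R X\<^esub> h"
    by (auto simp: fun_eq_iff free_algebra_simps l_distr)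
  show "h \<otimes>\<^bsub>free_algebra R X\<^esub> (f \<oplus>\<^bsub>free_algebra R X\<^esub> g) =
      h \<otimes>\<^bsub>free_algebra R X\<^esub> f \<oplus>\<^bsub>free_algebra R X\<^esub> h \<otimes>\<^bsub>free_algebra R X\<^esub> g"
    by (auto simp: fun_eq_iff free_algebra_simps r_distr)
qed

end

section \<open>The top coefficient functional\<close>

text \<open>The coefficient of \<open>v\<^sub>1 \<dots> v\<^sub>M\<close> in the image of a noncommutative polynomial in the
  Grassmann algebra.\<close>
definition top_coeff :: "('a, 'b) ring_scheme \<Rightarrow> nat \<Rightarrow> (nat list \<Rightarrow> 'a) \<Rightarrow> 'a" where
  "top_coeff R M f =
    (\<Oplus>\<^bsub>R\<^esub>\<sigma>\<in>{\<sigma>. \<sigma> permutes {1..M}}. [sign \<sigma>] \<cdot>\<^bsub>R\<^esub> f (map \<sigma> [1..<Suc M]))"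

text \<open>The value of the functional on a single word: the sign of \<sigma> for the word
  \<sigma>(1) ... \<sigma>(M), and 0 for any other word. It is kept as an integer so that the
  counting takes place in the integers and passes to \<open>R\<close> only at the end.\<close>

definition word_sign :: "nat \<Rightarrow> nat list \<Rightarrow> int" where
  "word_sign M w =
    (\<Sum>\<sigma> | \<sigma> permutes {1..M}. sign \<sigma> * of_bool (map \<sigma> [1..<Suc M] = w))"

context cring
begin

lemma top_coeff_closed: "f \<in> carrier (free_algebra R X) \<Longrightarrow> top_coeff R M f \<in> carrier R"
  unfolding top_coeff_def
  by (intro finsum_closed Pi_I add.int_pow_closed free_algebra_coeff_closed)

lemma top_coeff_add:
  assumes "f \<in> carrier (free_algebra R X)" "g \<in> carrier (free_algebra R X)"
  shows "top_coeff R M (f \<oplus>\<^bsub>free_algebra R X\<^esub> g) = top_coeff R M f \<oplus> top_coeff R M g"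
proof -
  note [simp] = assms[THEN free_algebra_coeff_closed]
  show ?thesis
    unfolding top_coeff_def
    by (subst finsum_addf[symmetric])
       (auto simp: add_free_algebra add.int_pow_mult_distrib a_comm intro!: finsum_cong')
qed

lemma top_coeff_monomial: "top_coeff R M (monomial R w) = [word_sign M w] \<cdot> \<one>"
proof -
  have "top_coeff R M (monomial R w) =
     (\<Oplus>\<sigma>\<in>{\<sigma>. \<sigma> permutes {1..M}}. [(sign \<sigma> * of_bool (map \<sigma> [1..<Suc M] = w))] \<cdot> \<one>)"
    unfolding top_coeff_def
    by (rule finsum_cong') (auto simp: monomial_def add_pow_zero simp del: upt_Suc)
  also have "\<dots> = [word_sign M w] \<cdot> \<one>"
    unfolding word_sign_def by (rule finsum_int_pow) (auto simp: finite_permutations)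
  finally show ?thesis .
qed

text \<open>Each term of the product reads \<open>r\<close> on a stretch of two adjacent letters.
  Exchanging them changes the sign of the permutation but not the term, so the terms cancel.\<close>

lemma top_coeff_mult_symmetric:
  assumes f: "f \<in> carrier (free_algebra R X)" and r: "r \<in> carrier (free_algebra R X)"
    and g: "g \<in> carrier (free_algebra R X)"
    and len: "\<And>w. length w \<noteq> 2 \<Longrightarrow> r w = \<zero>" and sym: "\<And>a b. r [a, b] = r [b, a]"
  shows "top_coeff R M (f \<otimes>\<^bsub>free_algebra R X\<^esub> r \<otimes>\<^bsub>free_algebra R X\<^esub> g) = \<zero>"
proof -
  note [simp] = f[THEN free_algebra_coeff_closed] g[THEN free_algebra_coeff_closed]
    r[THEN free_algebra_coeff_closed]
  let ?P = "{\<sigma>. \<sigma> permutes {1..M}}"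
  have fin: "finite ?P" by (simp add: finite_permutations)
  \<comment> \<open>Here \<open>f\<close> reads the first \<open>j\<close> letters of
    \<open>w\<close>, \<open>r\<close> the letters from \<open>j + 1\<close> to \<open>i\<close>,
    and \<open>g\<close> the rest.\<close>
  define T where "T = (\<lambda>i j w. f (take j (take i w)) \<otimes> r (drop j (take i w)) \<otimes> g (drop i w))"
  have Tc: "T i j w \<in> carrier R" for i j w by (simp add: T_def)
  have eq: "(f \<otimes>\<^bsub>free_algebra R X\<^esub> r \<otimes>\<^bsub>free_algebra R X\<^esub> g) w =
      (\<Oplus>i\<in>{..M}. \<Oplus>j\<in>{..i}. T i j w)" if "length w = M" for w
    unfolding mult_free_algebra that
  proof (rule finsum_cong')
    fix i assume "i \<in> {..M}"
    then have "length (take i w) = i" using that by simp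
    then show "(\<Oplus>j\<in>{..length (take i w)}. f (take j (take i w)) \<otimes> r (drop j (take i w))) \<otimes>
        g (drop i w) = (\<Oplus>j\<in>{..i}. T i j w)"
      unfolding T_def by (subst finsum_ldistr) auto
  qed (auto simp: Tc)
  have "top_coeff R M (f \<otimes>\<^bsub>free_algebra R X\<^esub> r \<otimes>\<^bsub>free_algebra R X\<^esub> g) =
      (\<Oplus>\<sigma>\<in>?P. [sign \<sigma>] \<cdot> (\<Oplus>i\<in>{..M}. \<Oplus>j\<in>{..i}. T i j (map \<sigma> [1..<Suc M])))"
    unfolding top_coeff_def
    by (rule finsum_cong') (auto simp: eq Tc simp del: upt_Suc intro!: finsum_closed)
  also have "\<dots> = (\<Oplus>i\<in>{..M}. \<Oplus>\<sigma>\<in>?P. [sign \<sigma>] \<cdot> (\<Oplus>j\<in>{..i}. T i j (map \<sigma> [1..<Suc M])))"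
    by (rule alternating_finsum_swap[OF fin]) (auto simp: Tc)
  also have "\<dots> = \<zero>"
  proof (rule add.finprod_one_eqI)
    fix i assume i: "i \<in> {..M}"
    have "(\<Oplus>\<sigma>\<in>?P. [sign \<sigma>] \<cdot> (\<Oplus>j\<in>{..i}. T i j (map \<sigma> [1..<Suc M]))) =
        (\<Oplus>j\<in>{..i}. \<Oplus>\<sigma>\<in>?P. [sign \<sigma>] \<cdot> T i j (map \<sigma> [1..<Suc M]))"
      by (rule alternating_finsum_swap[OF fin]) (auto simp: Tc)
    also have "\<dots> = \<zero>"
    proof (rule add.finprod_one_eqI)
      fix j assume j: "j \<in> {..i}"
      show "(\<Oplus>\<sigma>\<in>?P. [sign \<sigma>] \<cdot> T i j (map \<sigma> [1..<Suc M])) = \<zero>"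
      \<comment> \<open>If \<open>i = j + 2\<close>, then \<open>r\<close> reads exactly two letters
        and symmetry applies; otherwise \<open>r\<close> vanishes on the stretch.\<close>
      proof (cases "i = j + 2")
        case True
        then have jM: "j + 2 \<le> M" using i by simp
        have "T i j (map (\<sigma> \<circ> transpose (Suc j) (Suc (Suc j))) [1..<Suc M]) =
            T i j (map \<sigma> [1..<Suc M])" for \<sigma>
          unfolding map_comp_transpose_adjacent[OF jM] unfolding upt_split_two[OF jM] T_def True
          using sym[of "\<sigma> (Suc j)" "\<sigma> (Suc (Suc j))"] by (simp del: upt_Suc)
        then show ?thesis
          using jM by (intro alternating_finsum_eq_zero[of _ "Suc j" "Suc (Suc j)"]) (auto simp: Tc)
      next
        case False
        have "T i j w = \<zero>" if "length w = M" for w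
          using False i j that by (simp add: T_def len)
        then show ?thesis
          by (intro add.finprod_one_eqI) (simp del: upt_Suc)
      qed
    qed
    finally show "(\<Oplus>\<sigma>\<in>?P. [sign \<sigma>] \<cdot> (\<Oplus>j\<in>{..i}. T i j (map \<sigma> [1..<Suc M]))) = \<zero>" .
  qed
  finally show ?thesis .
qed

text \<open>The kernel of the functional is in general only an additive subgroup. Requiring the
  functional to vanish on all two-sided multiples cuts out the largest ideal inside the kernel;
  closure under multiplication follows by regrouping factors.\<close>

lemma top_coeff_ideal:
  fixes X :: "nat set"
  defines "F \<equiv> free_algebra R X"
  shows "ideal {f \<in> carrier F. \<forall>a\<in>carrier F. \<forall>b\<in>carrier F.
    top_coeff R M (a \<otimes>\<^bsub>F\<^esub> f \<otimes>\<^bsub>F\<^esub> b) = \<zero>} F" (is "ideal ?K F")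
proof -
  interpret F: ring F unfolding F_def by (rule free_algebra_ring)
  have add: "top_coeff R M (f \<oplus>\<^bsub>F\<^esub> g) = top_coeff R M f \<oplus> top_coeff R M g"
    if "f \<in> carrier F" "g \<in> carrier F" for f g
    using that unfolding F_def by (rule top_coeff_add)
  have closed: "top_coeff R M f \<in> carrier R" if "f \<in> carrier F" for f
    using that unfolding F_def by (rule top_coeff_closed)
  interpret t: group_hom "add_monoid F" "add_monoid R" "top_coeff R M"
    by unfold_locales (auto simp: hom_def add closed)
  have minus: "top_coeff R M (\<ominus>\<^bsub>F\<^esub> f) = \<ominus> top_coeff R M f" if "f \<in> carrier F" for f
    using t.hom_inv[of f] that by (simp add: a_inv_def)
  have zero: "top_coeff R M \<zero>\<^bsub>F\<^esub> = \<zero>" using t.hom_one by simp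
  show ?thesis
  proof (rule idealI)
    show "subgroup ?K (add_monoid F)"
    proof
      fix f assume f: "f \<in> ?K"
      have "\<ominus>\<^bsub>F\<^esub> f \<in> ?K"
        using f by (auto simp: F.r_minus F.l_minus minus)
      then show "inv\<^bsub>add_monoid F\<^esub> f \<in> ?K" by (simp add: a_inv_def)
    qed (auto simp: zero F.l_distr F.r_distr add)
  next
    fix f x assume f: "f \<in> ?K" and x: "x \<in> carrier F"
    show "x \<otimes>\<^bsub>F\<^esub> f \<in> ?K"
    proof safe
      fix a b assume "a \<in> carrier F" "b \<in> carrier F"
      then show "top_coeff R M (a \<otimes>\<^bsub>F\<^esub> (x \<otimes>\<^bsub>F\<^esub> f) \<otimes>\<^bsub>F\<^esub> b) = \<zero>"
        using f x by (simp flip: F.m_assoc)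
    qed (use f x in auto)
    show "f \<otimes>\<^bsub>F\<^esub> x \<in> ?K"
    proof safe
      fix a b assume "a \<in> carrier F" "b \<in> carrier F"
      moreover from this have "a \<otimes>\<^bsub>F\<^esub> (f \<otimes>\<^bsub>F\<^esub> x) \<otimes>\<^bsub>F\<^esub> b = a \<otimes>\<^bsub>F\<^esub> f \<otimes>\<^bsub>F\<^esub> (x \<otimes>\<^bsub>F\<^esub> b)"
        using f x by (simp add: F.m_assoc)
      ultimately show "top_coeff R M (a \<otimes>\<^bsub>F\<^esub> (f \<otimes>\<^bsub>F\<^esub> x) \<otimes>\<^bsub>F\<^esub> b) = \<zero>"
        using f x by simp
    qed (use f x in auto)
  qed (rule F.ring_axioms)
qed

lemma grassmann_relations_closed: "grassmann_relations R m \<subseteq> carrier (free_algebra R {1..m})"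
proof -
  define F where "F = free_algebra R {1..m}"
  interpret F: ring F unfolding F_def by (rule free_algebra_ring)
  have "monomial R [k] \<in> carrier F" if "1 \<le> k" "k \<le> m" for k
    unfolding F_def using that by (intro monomial_closed) simp
  then show ?thesis
    unfolding grassmann_relations_def Let_def free_gen_eq F_def[symmetric] by auto
qed

text \<open>The relations \<open>v_k v_k\<close> and \<open>v_i v_j + v_j v_i\<close> live on words
  of length two and take equal values on \<open>[x, y]\<close> and \<open>[y, x]\<close>, so they
  lie in the ideal of \<open>top_coeff_ideal\<close>, and with them the ideal they generate. Thus
  the functional descends to the Grassmann algebra.\<close>

lemma top_coeff_grassmann_ideal:
  assumes "f \<in> genideal (free_algebra R {1..m}) (grassmann_relations R m)"
  shows "top_coeff R M f = \<zero>"
proof -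
  define F where "F = free_algebra R {1..m}"
  interpret F: ring F unfolding F_def by (rule free_algebra_ring)
  let ?K = "{f \<in> carrier F. \<forall>a\<in>carrier F. \<forall>b\<in>carrier F.
    top_coeff R M (a \<otimes>\<^bsub>F\<^esub> f \<otimes>\<^bsub>F\<^esub> b) = \<zero>}"
  have "genideal F (grassmann_relations R m) \<subseteq> ?K"
  proof (rule F.genideal_minimal)
    show "ideal ?K F" unfolding F_def by (rule top_coeff_ideal)
    show "grassmann_relations R m \<subseteq> ?K"
    proof safe
      fix r a b assume r: "r \<in> grassmann_relations R m" and ab: "a \<in> carrier F" "b \<in> carrier F"
      have rF: "r \<in> carrier F" using r grassmann_relations_closed unfolding F_def by blast
      have "(\<forall>w. length w \<noteq> 2 \<longrightarrow> r w = \<zero>) \<and> (\<forall>x y. r [x, y] = r [y, x])"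
        using r unfolding grassmann_relations_def Let_def free_gen_eq monomial_mult
        by (auto simp: add_free_algebra monomial_def)
      then show "top_coeff R M (a \<otimes>\<^bsub>F\<^esub> r \<otimes>\<^bsub>F\<^esub> b) = \<zero>"
        using ab rF unfolding F_def by (intro top_coeff_mult_symmetric) auto
    qed (use grassmann_relations_closed in \<open>auto simp: F_def\<close>)
  qed
  with assms have "f \<in> ?K" unfolding F_def by blast
  then have "f \<in> carrier F" "top_coeff R M (\<one>\<^bsub>F\<^esub> \<otimes>\<^bsub>F\<^esub> f \<otimes>\<^bsub>F\<^esub> \<one>\<^bsub>F\<^esub>) = \<zero>"
    by blast+
  then show ?thesis by simp
qed

end

section \<open>Counting permutations with signs\<close>

text \<open>A permutation is determined by its word, so exactly one summand survives.\<close>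

lemma word_sign_permutes:
  assumes "q permutes {1..M}"
  shows "word_sign M (map q [1..<Suc M]) = sign q"
proof -
  have "map \<sigma> [1..<Suc M] = map q [1..<Suc M] \<longleftrightarrow> \<sigma> = q" if "\<sigma> permutes {1..M}" for \<sigma>
  proof
    assume "map \<sigma> [1..<Suc M] = map q [1..<Suc M]"
    then have "\<sigma> s = q s" if "s \<in> {1..M}" for s
      using that by (simp only: map_eq_conv set_upt) auto
    moreover have "\<sigma> s = q s" if "s \<notin> {1..M}" for s
      using permutes_not_in[OF assms that] permutes_not_in[OF \<open>\<sigma> permutes {1..M}\<close> that] by simp
    ultimately show "\<sigma> = q" by blast
  qed simp
  then have "word_sign M (map q [1..<Suc M]) =
      (\<Sum>\<sigma> | \<sigma> permutes {1..M}. if \<sigma> = q then sign \<sigma> else 0)"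
    unfolding word_sign_def by (intro sum.cong) auto
  also have "\<dots> = sign q"
    using assms by (subst sum.delta) (auto simp: finite_permutations)
  finally show ?thesis .
qed

text \<open>Such a permutation amounts to an independent choice of one permutation for every fibre
  of \<open>c\<close>.\<close>

lemma card_type_preserving_permutations:
  fixes c :: "'a \<Rightarrow> 'b"
  assumes "finite S"
  shows "card {p. p permutes S \<and> (\<forall>s\<in>S. c (p s) = c s)} =
    (\<Prod>b\<in>c ` S. fact (card {s \<in> S. c s = b}))"
proof -
  let ?B = "\<lambda>b. {s \<in> S. c s = b}"
  \<comment> \<open>\<open>?f\<close> glues a family of permutations of the fibres together;
    \<open>?g\<close> restricts a permutation to each fibre and extends it by the identity.\<close>
  let ?f = "\<lambda>g x. if x \<in> S then g (c x) x else x"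
  let ?g = "\<lambda>p. restrict (\<lambda>b. restrict_id p (?B b)) (c ` S)"
  have fin: "finite (?B b)" for b using assms by simp
  have "bij_betw ?f (\<Pi>\<^sub>E b\<in>c ` S. {q. q permutes ?B b}) {p. p permutes S \<and> (\<forall>s\<in>S. c (p s) = c s)}"
  proof (rule bij_betwI[of _ _ _ ?g])
    show "?f \<in> (\<Pi>\<^sub>E b\<in>c ` S. {q. q permutes ?B b}) \<rightarrow> {p. p permutes S \<and> (\<forall>s\<in>S. c (p s) = c s)}"
    proof
      fix g assume g: "g \<in> (\<Pi>\<^sub>E b\<in>c ` S. {q. q permutes ?B b})"
      have gq: "g (c s) permutes ?B (c s)" if "s \<in> S" for s
        using g that by auto
      have in_B: "g (c s) s \<in> ?B (c s)" if "s \<in> S" for s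
        using permutes_in_image[OF gq[OF that]] that by blast
      have "inj_on (?f g) S"
      proof (rule inj_onI)
        fix s t assume st: "s \<in> S" "t \<in> S" "?f g s = ?f g t"
        then have "c s = c t" using in_B[of s] in_B[of t] by auto
        with st permutes_inj[OF gq[of s]] show "s = t" by (auto dest: injD)
      qed
      moreover have "?f g ` S \<subseteq> S" using in_B by auto
      ultimately have "bij_betw (?f g) S S"
        using endo_inj_surj[OF assms] unfolding bij_betw_def by blast
      then have "?f g permutes S" by (rule bij_imp_permutes) simp
      then show "?f g \<in> {p. p permutes S \<and> (\<forall>s\<in>S. c (p s) = c s)}"
        using in_B by auto
    qed
    show "?g \<in> {p. p permutes S \<and> (\<forall>s\<in>S. c (p s) = c s)} \<rightarrow> (\<Pi>\<^sub>E b\<in>c ` S. {q. q permutes ?B b})"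
    proof
      fix p assume p: "p \<in> {p. p permutes S \<and> (\<forall>s\<in>S. c (p s) = c s)}"
      have "restrict_id p (?B b) permutes ?B b" for b
      proof (rule permutes_restrict_id)
        have "p ` ?B b \<subseteq> ?B b" using p by (auto simp: permutes_in_image)
        moreover have "inj_on p (?B b)" using p permutes_inj_on by blast
        ultimately show "bij_betw p (?B b) (?B b)"
          using endo_inj_surj[OF fin] unfolding bij_betw_def by blast
      qed
      then show "?g p \<in> (\<Pi>\<^sub>E b\<in>c ` S. {q. q permutes ?B b})" by auto
    qed
    show "?g (?f g) = g" if g: "g \<in> (\<Pi>\<^sub>E b\<in>c ` S. {q. q permutes ?B b})" for g
    proof (rule PiE_ext[OF _ g])
      show "?g (?f g) b = g b" if "b \<in> c ` S" for b
      proof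
        fix x
        have "g b permutes ?B b" using g that by auto
        then have "g b x = x" if "x \<notin> ?B b" using that by (rule permutes_not_in)
        then show "?g (?f g) b x = g b x" using that by (auto simp: restrict_id_def)
      qed
      then show "?g (?f g) \<in> (\<Pi>\<^sub>E b\<in>c ` S. {q. q permutes ?B b})"
        using g by (auto simp: PiE_def Pi_def)
    qed
    show "?f (?g p) = p" if "p \<in> {p. p permutes S \<and> (\<forall>s\<in>S. c (p s) = c s)}" for p
      using that by (auto simp: fun_eq_iff restrict_id_def permutes_not_in)
  qed
  then have "card {p. p permutes S \<and> (\<forall>s\<in>S. c (p s) = c s)} =
      card (\<Pi>\<^sub>E b\<in>c ` S. {q. q permutes ?B b})"
    by (rule bij_betw_same_card[symmetric])
  also have "\<dots> = (\<Prod>b\<in>c ` S. fact (card (?B b)))"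
    using assms by (simp add: card_PiE card_permutations[OF refl])
  finally show ?thesis .
qed

text \<open>
  Slots \<open>1, \<dots>, 2h\<close> carry the generators and slots \<open>2h + 1, \<dots>, 2h + N\<close> the bare matrix units; the type
  of a slot is the number of its matrix unit.
\<close>
definition slot_type :: "nat \<Rightarrow> nat \<Rightarrow> nat \<Rightarrow> nat" where
  "slot_type h N t = (if t \<le> 2 * h then ((t - 1) div 2) mod N else t - 2 * h - 1)"

text \<open>The indices of the generators in the order in which the first \<open>t\<close> slots
  present them; arguments above \<open>M\<close> are bare matrix units and contribute
  nothing.\<close>

definition generator_word :: "nat \<Rightarrow> (nat \<Rightarrow> nat) \<Rightarrow> nat \<Rightarrow> nat list" where
  "generator_word M p t = filter (\<lambda>s. s \<le> M) (map p [1..<Suc t])"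

text \<open>At most one of the two exchanged arguments carries a generator, so the order of the
  generators stays the same.\<close>

lemma generator_word_swap:
  assumes "j + 2 \<le> k" and "M < p (Suc j) \<or> M < p (Suc (Suc j))"
  shows "generator_word M (p \<circ> transpose (Suc j) (Suc (Suc j))) k = generator_word M p k"
  unfolding generator_word_def map_comp_transpose_adjacent[OF assms(1)]
  unfolding upt_split_two[OF assms(1)] using assms(2) by (auto simp del: upt_Suc)

definition partner :: "nat \<Rightarrow> nat" where
  "partner t = (if odd t then t + 1 else t - 1)"

text \<open>The set \<open>B\<close> serves an induction: it grows from the empty set to the set of
  all bare matrix units, which \<open>p\<close> is then forced to fix.\<close>

definition type_preserving :: "(nat \<Rightarrow> nat) \<Rightarrow> nat \<Rightarrow> nat set \<Rightarrow> (nat \<Rightarrow> nat) set" where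
  "type_preserving c k B =
    {p. p permutes {1..k} \<and> (\<forall>s\<in>{1..k}. c (p s) = c s) \<and> (\<forall>u\<in>B. p u = u)}"

text \<open>The integer that \<open>p\<close> contributes to the Capelli polynomial: its sign there,
  times the sign picked up when the product of generators is sorted into
  \<open>v_1 ... v_M\<close>.\<close>

definition capelli_weight :: "nat \<Rightarrow> nat \<Rightarrow> (nat \<Rightarrow> nat) \<Rightarrow> int" where
  "capelli_weight M k p = sign p * word_sign M (generator_word M p k)"

lemma partner_partner: "1 \<le> t \<Longrightarrow> partner (partner t) = t"
  by (auto simp: partner_def)

context
  fixes h N M k :: nat
  assumes N: "0 < N" and M: "M = 2 * h" and k: "k = N + M"
begin

text \<open>
  If \<open>u\<close> is not fixed by \<open>p\<close>, then it occupies a generator slot of its own type.  Exchanging this slot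
  with its partner is a sign-reversing involution.
\<close>
lemma sum_type_preserving_insert:
  assumes u: "u \<in> {Suc M..k}" and B: "B \<subseteq> {Suc M..k}" "u \<notin> B"
  shows "sum (capelli_weight M k) (type_preserving (slot_type h N) k B) =
    sum (capelli_weight M k) (type_preserving (slot_type h N) k (insert u B))"
proof -
  let ?D = "type_preserving (slot_type h N) k B - type_preserving (slot_type h N) k (insert u B)"
  have fin: "finite (type_preserving (slot_type h N) k B)"
    unfolding type_preserving_def
    by (rule finite_subset[OF _ finite_permutations[of "{1..k}"]]) auto
  \<comment> \<open>The slot occupied by the argument \<open>u\<close> is
    \<open>inv_into UNIV p u\<close>; the exchange moves \<open>u\<close> into the partner
    slot.\<close>
  define swap where "swap p = p \<circ> transpose (inv_into UNIV p u) (partner (inv_into UNIV p u))"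
    for p :: "nat \<Rightarrow> nat"
  have *: "swap p \<in> ?D \<and> swap (swap p) = p \<and>
      capelli_weight M k (swap p) = - capelli_weight M k p" if p: "p \<in> ?D" for p
  proof -
    have pp: "p permutes {1..k}" and tp: "\<And>s. s \<in> {1..k} \<Longrightarrow> slot_type h N (p s) = slot_type h N s"
      and fixB: "\<And>u. u \<in> B \<Longrightarrow> p u = u" and pu: "p u \<noteq> u"
      using p by (auto simp: type_preserving_def)
    define s where "s = inv_into UNIV p u"
    have ps: "p s = u" unfolding s_def using permutes_inverses[OF pp] by simp
    have uk: "u \<in> {1..k}" using u by simp
    have sk: "s \<in> {1..k}" using ps uk permutes_in_image[OF pp] by metis
    have "s \<noteq> u" using ps pu by auto
    \<comment> \<open>Different bare slots have different types. As \<open>s\<close> differs from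
      \<open>u\<close> but shares its type, it must be a generator slot.\<close>
    moreover have "slot_type h N s = slot_type h N u" using tp[OF sk] ps by simp
    ultimately have sM: "s \<le> M" using u by (auto simp: slot_type_def M split: if_splits)
    \<comment> \<open>The pair containing \<open>s\<close> consists of \<open>j + 1\<close> and
      \<open>j + 2\<close>. Evenness of \<open>j\<close> ensures that these two slots were dealt to
      the same matrix unit.\<close>
    obtain j where j: "j + 2 \<le> M" and js: "(s = Suc j \<and> partner s = Suc (Suc j)) \<or>
        (s = Suc (Suc j) \<and> partner s = Suc j)" and evj: "even j"
    proof (cases "odd s")
      case True
      show ?thesis
      proof (rule that[of "s - 1"])
        have "s \<noteq> M" using True M by auto
        then show "s - 1 + 2 \<le> M" using sM sk by auto
      qed (use True in \<open>auto simp: partner_def\<close>)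
    next
      case False
      then have "2 \<le> s" using sk by (cases "s = 1") auto
      then obtain t where "s = Suc (Suc t)" by (metis add_2_eq_Suc le_Suc_ex)
      then show ?thesis using that[of t] False sM by (auto simp: partner_def)
    qed
    have swp: "swap p = p \<circ> transpose (Suc j) (Suc (Suc j))"
      using js unfolding swap_def s_def[symmetric] by (auto simp: transpose_commute)
    have tr: "transpose (Suc j) (Suc (Suc j)) permutes {1..k}"
      using j k by (intro permutes_swap_id) auto
    have sp: "swap p permutes {1..k}"
      unfolding swp by (rule permutes_compose[OF tr pp])
    have typj: "slot_type h N (Suc j) = slot_type h N (Suc (Suc j))"
      using j evj by (auto simp: slot_type_def M)
    have "slot_type h N (transpose (Suc j) (Suc (Suc j)) t) = slot_type h N t" for t
      using typj by (auto simp: transpose_def)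
    moreover have "transpose (Suc j) (Suc (Suc j)) t \<in> {1..k}" if "t \<in> {1..k}" for t
      using permutes_in_image[OF tr] that by blast
    ultimately have typs: "slot_type h N (swap p t) = slot_type h N t" if "t \<in> {1..k}" for t
      using tp that unfolding swp comp_def by metis
    have fixed: "swap p v = p v" if "M < v" for v
      using that j unfolding swp by (auto simp: transpose_def)
    \<comment> \<open>After the exchange \<open>u\<close> sits in the partner slot, so a second
      exchange uses the same pair and undoes the first.\<close>
    have invs: "inv_into UNIV (swap p) u = partner s"
    proof -
      have "swap p (partner s) = u" using js ps unfolding swp by auto
      then show ?thesis using sp by (metis permutes_inv_eq)
    qed
    have pa: "partner (partner s) = s" using sk by (intro partner_partner) auto
    have "swap (swap p) = p"
      unfolding swap_def[of "swap p"] invs pa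
      unfolding swap_def s_def[symmetric] by (simp add: fun_eq_iff transpose_commute)
    \<comment> \<open>Both exchanged slots are at most \<open>M\<close>, so the values at
      \<open>u\<close> and on \<open>B\<close> are unchanged: \<open>B\<close> remains fixed and
      \<open>u\<close> remains moved.\<close>
    moreover have "swap p \<in> ?D"
      using sp typs fixed fixB B u pu by (auto simp: type_preserving_def)
    moreover have "generator_word M (swap p) k = generator_word M p k"
      unfolding swp by (rule generator_word_swap) (use j js ps u in auto)
    moreover have "sign (swap p) = - sign p"
    proof -
      have "permutation p" "permutation (transpose (Suc j) (Suc (Suc j)))"
        using pp tr permutation_permutes by blast+
      then show ?thesis unfolding swp by (simp add: sign_compose sign_swap_id)
    qed
    ultimately show ?thesis by (simp add: capelli_weight_def)
  qed
  \<comment> \<open>The involution makes this integer equal to its own negative, hence zero.\<close>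
  have "sum (capelli_weight M k) ?D = sum (\<lambda>p. - capelli_weight M k p) ?D"
    by (rule sum.reindex_bij_witness[of _ swap swap]) (use * in auto)
  then have "sum (capelli_weight M k) ?D = 0" by (simp add: sum_negf)
  moreover have "type_preserving (slot_type h N) k (insert u B) \<subseteq> type_preserving (slot_type h N) k B"
    by (auto simp: type_preserving_def)
  ultimately show ?thesis
    using sum.subset_diff[OF _ fin, of "type_preserving (slot_type h N) k (insert u B)" "capelli_weight M k"]
    by simp
qed

lemma sum_type_preserving:
  "B \<subseteq> {Suc M..k} \<Longrightarrow> sum (capelli_weight M k) (type_preserving (slot_type h N) k {}) =
    sum (capelli_weight M k) (type_preserving (slot_type h N) k B)"
proof (induction B rule: infinite_finite_induct)
  case (infinite B)
  then show ?case using finite_subset by blast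
next
  case (insert u B)
  then show ?case using sum_type_preserving_insert[of u B] by auto
qed simp

text \<open>The sign of \<open>q\<close> occurs twice, once from the Capelli polynomial and once
  from sorting the generators. Its square is 1, so nothing cancels among these permutations.\<close>

lemma capelli_weight_generators_only:
  assumes "q permutes {1..M}"
  shows "capelli_weight M k q = 1"
proof -
  have qM: "q s \<le> M" if "s \<in> {1..M}" for s
    using permutes_in_image[OF assms, of s] that by simp
  have "[1..<Suc k] = [1..<Suc M] @ [Suc M..<Suc k]"
    unfolding k using upt_add_eq_append[of 1 "Suc M" N] by (simp add: add.commute del: upt_Suc)
  moreover have "filter (\<lambda>s. s \<le> M) (map q [1..<Suc M]) = map q [1..<Suc M]"
    using qM by (intro filter_True) (auto simp del: upt_Suc)
  moreover have "filter (\<lambda>s. s \<le> M) (map q [Suc M..<Suc k]) = []"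
    using permutes_not_in[OF assms] by (intro filter_False) auto
  ultimately have "generator_word M q k = map q [1..<Suc M]"
    by (simp only: generator_word_def map_append filter_append append_Nil2)
  then show ?thesis
    using word_sign_permutes[OF assms] by (simp only: capelli_weight_def sign_idempotent)
qed

text \<open>Once all bare matrix units are forced to be fixed, the type-preserving permutations of
  the generators remain, each with weight 1, and they are counted block by block.\<close>

lemma sum_capelli_weight:
  "sum (capelli_weight M k) (type_preserving (slot_type h N) k {}) =
    int (\<Prod>b\<in>slot_type h N ` {1..M}. fact (card {s \<in> {1..M}. slot_type h N s = b}))"
proof -
  have "type_preserving (slot_type h N) k {Suc M..k} =
      {p. p permutes {1..M} \<and> (\<forall>s\<in>{1..M}. slot_type h N (p s) = slot_type h N s)}"
  proof safe
    fix p assume p: "p \<in> type_preserving (slot_type h N) k {Suc M..k}"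
    then have pk: "p permutes {1..k}" and fx: "\<forall>u\<in>{Suc M..k}. p u = u"
      and tp: "\<forall>s\<in>{1..k}. slot_type h N (p s) = slot_type h N s"
      unfolding type_preserving_def by blast+
    have "p u = u" if "u \<in> {1..k} - {1..M}" for u
      by (rule bspec[OF fx]) (use that in auto)
    with pk show "p permutes {1..M}" by (rule permutes_superset)
    show "slot_type h N (p s) = slot_type h N s" if "s \<in> {1..M}" for s
      using tp that k by simp
  next
    fix p assume p: "p permutes {1..M}" and tp: "\<forall>s\<in>{1..M}. slot_type h N (p s) = slot_type h N s"
    have fx: "p u = u" if "u \<notin> {1..M}" for u using permutes_not_in[OF p that] .
    have "p permutes {1..k}" by (rule permutes_subset[OF p]) (simp add: k)
    moreover have "slot_type h N (p s) = slot_type h N s" for s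
      using tp fx[of s] by (cases "s \<in> {1..M}") auto
    ultimately show "p \<in> type_preserving (slot_type h N) k {Suc M..k}"
      using fx by (auto simp: type_preserving_def)
  qed
  then have "sum (capelli_weight M k) (type_preserving (slot_type h N) k {}) =
      (\<Sum>p | p permutes {1..M} \<and> (\<forall>s\<in>{1..M}. slot_type h N (p s) = slot_type h N s).
        capelli_weight M k p)"
    using sum_type_preserving[of "{Suc M..k}"] by simp
  also have "\<dots> = (\<Sum>p | p permutes {1..M} \<and> (\<forall>s\<in>{1..M}. slot_type h N (p s) = slot_type h N s). 1)"
    by (rule sum.cong[OF refl]) (use capelli_weight_generators_only in blast)
  also have "\<dots> = int (card {p. p permutes {1..M} \<and>
      (\<forall>s\<in>{1..M}. slot_type h N (p s) = slot_type h N s)})"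
    by simp
  finally show ?thesis using card_type_preserving_permutations[of "{1..M}" "slot_type h N"] by simp
qed

text \<open>A generator slot of a given type is determined by the round of the cyclic distribution
  in which its pair was dealt and by its position in the pair. There are at most \<open>q\<close>
  rounds and two positions.\<close>

lemma card_type_block: "card {s \<in> {1..M}. slot_type h N s = b} \<le> nat (2 * \<lceil>real h / real N\<rceil>)"
proof -
  define q where "q = nat \<lceil>real h / real N\<rceil>"
  let ?f = "\<lambda>s. ((s - 1) div 2 div N, (s - 1) mod 2)"
  have "card {s \<in> {1..M}. slot_type h N s = b} \<le> card ({..<q} \<times> {..<2::nat})"
  proof (rule card_inj_on_le[of ?f])
    show "inj_on ?f {s \<in> {1..M}. slot_type h N s = b}"
    proof (rule inj_onI)
      fix s t assume st: "s \<in> {s \<in> {1..M}. slot_type h N s = b}"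
        "t \<in> {s \<in> {1..M}. slot_type h N s = b}" "?f s = ?f t"
      then have "(s - 1) div 2 mod N = (t - 1) div 2 mod N"
        "(s - 1) div 2 div N = (t - 1) div 2 div N"
        by (auto simp: slot_type_def M)
      then have "(s - 1) div 2 = (t - 1) div 2" by (metis div_mult_mod_eq)
      moreover have "(s - 1) mod 2 = (t - 1) mod 2" using st by simp
      ultimately have "s - 1 = t - 1" by (metis div_mult_mod_eq)
      then show "s = t" using st by auto
    qed
    show "?f ` {s \<in> {1..M}. slot_type h N s = b} \<subseteq> {..<q} \<times> {..<2}"
    proof (rule image_subsetI)
      fix s assume "s \<in> {s \<in> {1..M}. slot_type h N s = b}"
      then have "real ((s - 1) div 2) < real h" by (auto simp: M)
      then have "real ((s - 1) div 2) / real N < real h / real N"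
        using N by (intro divide_strict_right_mono) auto
      moreover have "real ((s - 1) div 2 div N) \<le> real ((s - 1) div 2) / real N"
        by (rule of_nat_div_le_of_nat)
      moreover have "real h / real N \<le> of_int \<lceil>real h / real N\<rceil>" by simp
      ultimately have "(s - 1) div 2 div N < q" unfolding q_def by linarith
      then show "?f s \<in> {..<q} \<times> {..<2}" by simp
    qed
  qed simp
  also have "\<dots> = nat (2 * \<lceil>real h / real N\<rceil>)"
    by (simp add: q_def nat_mult_distrib)
  finally show ?thesis .
qed

end

section \<open>Matrix units\<close>

lemma carrier_matrix_ring:
  "A \<in> carrier (matrix_ring n S) \<longleftrightarrow>
    A \<in> carrier_mat n n \<and> (\<forall>i<n. \<forall>j<n. A $$ (i, j) \<in> carrier S)"
  by (auto simp: matrix_ring_def elements_mat_def UN_subset_iff image_subset_iff)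

lemma add_matrix_ring:
  "A \<oplus>\<^bsub>matrix_ring n S\<^esub> B = mat n n (\<lambda>(i, j). A $$ (i, j) \<oplus>\<^bsub>S\<^esub> B $$ (i, j))"
  by (simp add: matrix_ring_def)

lemma zero_matrix_ring: "\<zero>\<^bsub>matrix_ring n S\<^esub> = mat n n (\<lambda>(i, j). \<zero>\<^bsub>S\<^esub>)"
  by (simp add: matrix_ring_def)

lemma mult_matrix_ring:
  "A \<otimes>\<^bsub>matrix_ring n S\<^esub> B = mat n n (\<lambda>(i, j). \<Oplus>\<^bsub>S\<^esub>l\<in>{..<n}. A $$ (i, l) \<otimes>\<^bsub>S\<^esub> B $$ (l, j))"
  by (simp add: matrix_ring_def)

lemma (in abelian_group) matrix_ring_abelian_group: "abelian_group (matrix_ring n G)"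
proof (rule abelian_groupI)
  fix A assume A: "A \<in> carrier (matrix_ring n G)"
  have "mat n n (\<lambda>(i, j). \<ominus> A $$ (i, j)) \<in> carrier (matrix_ring n G)"
    using A by (auto simp: carrier_matrix_ring)
  moreover have "mat n n (\<lambda>(i, j). \<ominus> A $$ (i, j)) \<oplus>\<^bsub>matrix_ring n G\<^esub> A = \<zero>\<^bsub>matrix_ring n G\<^esub>"
    using A by (auto simp: add_matrix_ring zero_matrix_ring carrier_matrix_ring l_neg)
  ultimately show "\<exists>B\<in>carrier (matrix_ring n G). B \<oplus>\<^bsub>matrix_ring n G\<^esub> A = \<zero>\<^bsub>matrix_ring n G\<^esub>"
    by blast
qed (auto simp: carrier_matrix_ring add_matrix_ring zero_matrix_ring a_ac intro!: eq_matI)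

definition matrix_unit :: "nat \<Rightarrow> ('a, 'b) ring_scheme \<Rightarrow> nat \<Rightarrow> nat \<Rightarrow> 'a \<Rightarrow> 'a mat" where
  "matrix_unit n S i j e = mat n n (\<lambda>(a, b). if a = i \<and> b = j then e else \<zero>\<^bsub>S\<^esub>)"

context ring
begin

lemma matrix_unit_closed: "e \<in> carrier R \<Longrightarrow> matrix_unit n R i j e \<in> carrier (matrix_ring n R)"
  by (simp add: carrier_matrix_ring matrix_unit_def)

text \<open>The mismatched case is written with entry zero, so that products of matrix units always
  keep the same shape and one invariant serves the induction over long products.\<close>

lemma matrix_unit_mult:
  assumes e: "e \<in> carrier R" and f: "f \<in> carrier R" and j: "j < n"
  shows "matrix_unit n R i j e \<otimes>\<^bsub>matrix_ring n R\<^esub> matrix_unit n R k l f =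
    matrix_unit n R i l (if j = k then e \<otimes> f else \<zero>)"
proof (rule eq_matI)
  fix a b
  assume "a < dim_row (matrix_unit n R i l (if j = k then e \<otimes> f else \<zero>))"
    "b < dim_col (matrix_unit n R i l (if j = k then e \<otimes> f else \<zero>))"
  then have ab: "a < n" "b < n" by (auto simp: matrix_unit_def)
  have "(\<Oplus>c\<in>{..<n}. matrix_unit n R i j e $$ (a, c) \<otimes> matrix_unit n R k l f $$ (c, b)) =
     (\<Oplus>c\<in>{..<n}. if j = c then (if a = i \<and> b = l \<and> j = k then e \<otimes> f else \<zero>) else \<zero>)"
    by (rule finsum_cong') (use ab e f in \<open>auto simp: matrix_unit_def\<close>)
  also have "\<dots> = (if a = i \<and> b = l \<and> j = k then e \<otimes> f else \<zero>)"
    using finsum_singleton[of j "{..<n}" "\<lambda>_. if a = i \<and> b = l \<and> j = k then e \<otimes> f else \<zero>"]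
      j e f by auto
  finally show "(matrix_unit n R i j e \<otimes>\<^bsub>matrix_ring n R\<^esub> matrix_unit n R k l f) $$ (a, b) =
      matrix_unit n R i l (if j = k then e \<otimes> f else \<zero>) $$ (a, b)"
    using ab by (simp add: mult_matrix_ring) (simp add: matrix_unit_def)
qed (simp_all add: mult_matrix_ring matrix_unit_def)

text \<open>The \<open>y\<close> are bridges: \<open>y t\<close> leads from the column of slot
  \<open>t\<close> to the row of slot \<open>t + 1\<close>. So \<open>x (p s)\<close>, placed
  between \<open>y (s - 1)\<close> and \<open>y s\<close>, fits only if its row and column are those
  of slot \<open>s\<close>. Index 0 at both ends puts the full product into position (0, 0), and
  \<open>P\<close> is the running product of the entries.\<close>

lemma alternating_product_matrix_units:
  assumes n: "0 < n" and bnd: "\<And>t. t \<in> {1..k} \<Longrightarrow> ri t < n \<and> ci t < n"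
    and p: "p permutes {1..k}" and e: "\<And>t. t \<in> {1..k} \<Longrightarrow> e t \<in> carrier R"
    and P0: "P 0 = \<one>" and P: "\<And>t. t < k \<Longrightarrow> P (Suc t) = P t \<otimes> e (p (Suc t))"
  defines "\<rho> \<equiv> \<lambda>t. if t < k then ri (Suc t) else 0"
  defines "x \<equiv> \<lambda>t. matrix_unit n R (ri t) (ci t) (e t)"
  defines "y \<equiv> \<lambda>t. matrix_unit n R (if t = 0 then 0 else ci t) (\<rho> t) \<one>"
  assumes t: "t \<le> k"
  shows "P t \<in> carrier R \<and> alternating_product (matrix_ring n R) t (x \<circ> p) y =
    matrix_unit n R 0 (\<rho> t)
      (if \<forall>s\<in>{1..t}. ri (p s) = ri s \<and> ci (p s) = ci s then P t else \<zero>)"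
  using t
proof (induction t)
  case 0
  then show ?case by (simp add: y_def P0)
next
  case (Suc t)
  have pS: "p (Suc t) \<in> {1..k}"
    using p Suc.prems by (simp add: permutes_in_image del: atLeastAtMost_iff) simp
  have [simp]: "P t \<in> carrier R" using Suc by simp
  have [simp]: "e (p (Suc t)) \<in> carrier R" using pS e by blast
  have \<rho>: "\<rho> t = ri (Suc t)" "ri (Suc t) < n" using Suc.prems bnd[of "Suc t"] by (auto simp: \<rho>_def)
  have c: "ci (p (Suc t)) < n" using pS bnd by blast
  have split: "(\<forall>s\<in>{1..Suc t}. Q s) \<longleftrightarrow> (\<forall>s\<in>{1..t}. Q s) \<and> Q (Suc t)" for Q
    by (subst atLeastAtMostSuc_conv) auto
  show ?case
    using Suc \<rho> c unfolding split
    by (auto simp: x_def y_def matrix_unit_mult P)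
qed

end

text \<open>An additive map that vanishes on the ideal is constant on cosets, so it may be evaluated
  at a chosen representative. This is applied to the top coefficient, which is additive but not a
  ring homomorphism.\<close>

lemma (in ideal) coset_functional_exists:
  assumes h: "\<And>a b. a \<in> carrier R \<Longrightarrow> b \<in> carrier R \<Longrightarrow> h (a \<oplus> b) = h a \<oplus>\<^bsub>B\<^esub> h b"
    and closed: "\<And>a. a \<in> carrier R \<Longrightarrow> h a \<in> carrier B"
    and zero: "\<And>a. a \<in> I \<Longrightarrow> h a = \<zero>\<^bsub>B\<^esub>" and B: "abelian_group B"
  obtains \<phi> where "\<And>a. a \<in> carrier R \<Longrightarrow> \<phi> (I +> a) = h a"
    and "\<And>a b. a \<in> carrier (R Quot I) \<Longrightarrow> b \<in> carrier (R Quot I) \<Longrightarrow>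
      \<phi> (a \<oplus>\<^bsub>R Quot I\<^esub> b) = \<phi> a \<oplus>\<^bsub>B\<^esub> \<phi> b"
    and "\<And>a. a \<in> carrier (R Quot I) \<Longrightarrow> \<phi> a \<in> carrier B"
proof -
  interpret B: abelian_group B by fact
  define \<phi> where "\<phi> = (\<lambda>C. h (SOME a. a \<in> C))"
  have 1: "\<phi> (I +> a) = h a" if a: "a \<in> carrier R" for a
  proof -
    have "(SOME b. b \<in> I +> a) \<in> I +> a"
      using a_rcos_self[OF a] by (rule someI)
    then obtain i where "i \<in> I" "(SOME b. b \<in> I +> a) = i \<oplus> a"
      by (auto simp: a_r_coset_def r_coset_def)
    then show ?thesis
      using a h[of i a] closed[OF a] by (simp add: \<phi>_def zero Icarr)
  qed
  have carr: "\<exists>a\<in>carrier R. C = I +> a" if "C \<in> carrier (R Quot I)" for C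
    using that by (auto simp: FactRing_simps)
  show ?thesis
  proof
    show "\<phi> (a \<oplus>\<^bsub>R Quot I\<^esub> b) = \<phi> a \<oplus>\<^bsub>B\<^esub> \<phi> b"
      if "a \<in> carrier (R Quot I)" "b \<in> carrier (R Quot I)" for a b
      using carr[OF that(1)] carr[OF that(2)]
      by (auto simp: 1 h FactRing_def a_rcos_sum)
    show "\<phi> a \<in> carrier B" if "a \<in> carrier (R Quot I)" for a
      using carr[OF that] by (auto simp: 1 closed)
  qed (rule 1)
qed

section \<open>The Capelli polynomial of the Grassmann matrices\<close>

lemma slot_type_less: "0 < N \<Longrightarrow> t \<in> {1..N + 2 * h} \<Longrightarrow> slot_type h N t < N"
  by (auto simp: slot_type_def)

theorem proposition6:
  fixes R :: "('a, 'b) ring_scheme" and m n :: nat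
  assumes "field R"
    and "n \<ge> 1"
    and "ring_char R = 0 \<or>
      (prime (ring_char R) \<and> int (ring_char R) > 2 * \<lceil>real (m div 2) / real (n\<^sup>2)\<rceil>)"
  shows "\<not> satisfies_capelli (matrix_ring n (grassmann_algebra R m)) (n\<^sup>2 + 2 * (m div 2))"
proof
  assume sat: "satisfies_capelli (matrix_ring n (grassmann_algebra R m)) (n\<^sup>2 + 2 * (m div 2))"
  interpret field R by fact
  define h where "h = m div 2"
  \<comment> \<open>\<open>M\<close> is the largest even number up to \<open>m\<close>; for odd
    \<open>m\<close> the last generator is left out.\<close>
  define M where "M = 2 * h"
  define N where "N = n\<^sup>2"
  define k where "k = N + M"
  define c where "c = slot_type h N"
  define F where "F = free_algebra R {1..m}"
  define I where "I = genideal F (grassmann_relations R m)"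
  define E where "E = F Quot I"
  define A where "A = matrix_ring n E"
  have Mm: "M \<le> m" by (simp add: M_def h_def)
  have N0: "0 < N" using \<open>n \<ge> 1\<close> by (simp add: N_def)
  interpret F: ring F unfolding F_def by (rule free_algebra_ring)
  interpret I: ideal I F
    unfolding I_def using grassmann_relations_closed by (intro F.genideal_ideal) (simp add: F_def)
  interpret E: ring E unfolding E_def by (rule I.quotient_is_ring)
  interpret A: abelian_group A unfolding A_def by (rule E.matrix_ring_abelian_group)
  define \<pi> where "\<pi> = (\<lambda>f. I +>\<^bsub>F\<^esub> f)"
  interpret \<pi>: ring_hom_ring F E \<pi>
    unfolding \<pi>_def E_def by (rule I.rcos_ring_hom_ring)
  have top_I: "top_coeff R M f = \<zero>\<^bsub>R\<^esub>" if "f \<in> I" for f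
    using that unfolding I_def F_def by (rule top_coeff_grassmann_ideal)
  obtain \<phi> where \<phi>: "\<And>f. f \<in> carrier F \<Longrightarrow> \<phi> (\<pi> f) = top_coeff R M f"
    and \<phi>_add: "\<And>a b. a \<in> carrier E \<Longrightarrow> b \<in> carrier E \<Longrightarrow> \<phi> (a \<oplus>\<^bsub>E\<^esub> b) = \<phi> a \<oplus>\<^bsub>R\<^esub> \<phi> b"
    and \<phi>_closed: "\<And>a. a \<in> carrier E \<Longrightarrow> \<phi> a \<in> carrier R"
    unfolding \<pi>_def E_def
    by (rule I.coset_functional_exists[of "top_coeff R M" R])
       (auto simp: F_def top_coeff_add top_coeff_closed top_I[unfolded F_def] abelian_group_axioms)
  have \<phi>_zero: "\<phi> \<zero>\<^bsub>E\<^esub> = \<zero>\<^bsub>R\<^esub>"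
    using \<phi>[OF F.zero_closed] top_I[OF I.zero_closed] by simp

  have mono: "monomial R w \<in> carrier F" if "set w \<subseteq> {1..M}" for w
    unfolding F_def using that Mm by (intro monomial_closed) auto
  \<comment> \<open>The entry of the argument \<open>x t\<close>: the class of the generator
    \<open>v_t\<close> for \<open>t\<close> up to \<open>M\<close>, and the unit beyond.\<close>
  define e where "e = (\<lambda>t. \<pi> (monomial R (if t \<le> M then [t] else [])))"
  have e_closed: "e t \<in> carrier E" if "t \<in> {1..k}" for t
    using that unfolding e_def by (intro \<pi>.hom_closed mono) auto
  have word: "set (generator_word M p t) \<subseteq> {1..M}" if p: "p permutes {1..k}" and t: "t \<le> k" for p t
  proof -
    have "1 \<le> p s" if "s \<in> {1..t}" for s
      using permutes_in_image[OF p, of s] that t by simp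
    then show ?thesis by (auto simp: generator_word_def simp del: upt_Suc)
  qed
  define P where "P = (\<lambda>p t. \<pi> (monomial R (generator_word M p t)))"
  have P0: "P p 0 = \<one>\<^bsub>E\<^esub>" for p
    using \<pi>.hom_one by (simp add: P_def generator_word_def F_def one_free_algebra_eq)
  have PSuc: "P p (Suc t) = P p t \<otimes>\<^bsub>E\<^esub> e (p (Suc t))"
    if p: "p permutes {1..k}" and t: "t < k" for p t
  proof -
    let ?u = "generator_word M p t" and ?v = "if p (Suc t) \<le> M then [p (Suc t)] else []"
    have eq: "generator_word M p (Suc t) = ?u @ ?v" by (simp add: generator_word_def)
    have uv: "set ?u \<subseteq> {1..M}" "set ?v \<subseteq> {1..M}"
      using word[OF p, of t] word[OF p, of "Suc t"] t unfolding eq by auto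
    have "\<pi> (monomial R ?u) \<otimes>\<^bsub>E\<^esub> \<pi> (monomial R ?v) = \<pi> (monomial R ?u \<otimes>\<^bsub>F\<^esub> monomial R ?v)"
      by (rule \<pi>.hom_mult[OF mono[OF uv(1)] mono[OF uv(2)], symmetric])
    also have "monomial R ?u \<otimes>\<^bsub>F\<^esub> monomial R ?v = monomial R (?u @ ?v)"
      unfolding F_def by (rule monomial_mult)
    finally show ?thesis
      unfolding P_def e_def eq by (rule sym)
  qed

  \<comment> \<open>The substituted matrix units and the value of each summand\<close>
  define ri where "ri = (\<lambda>t. c t div n)"
  define ci where "ci = (\<lambda>t. c t mod n)"
  \<comment> \<open>Types are numbers below \<open>n * n\<close>; quotient and remainder by
    \<open>n\<close> read them as row and column of a matrix unit.\<close>
  have bnd: "ri t < n \<and> ci t < n" if "t \<in> {1..k}" for t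
  proof -
    have "c t < n * n"
      using slot_type_less[OF N0, of t h] that
      by (simp add: c_def k_def M_def N_def power2_eq_square)
    then show ?thesis
      using \<open>n \<ge> 1\<close> by (simp add: ri_def ci_def less_mult_imp_div_less)
  qed
  have type_eq: "ri s = ri t \<and> ci s = ci t \<longleftrightarrow> c s = c t" for s t
    unfolding ri_def ci_def by (metis div_mult_mod_eq)
  define x where "x = (\<lambda>t. matrix_unit n E (ri t) (ci t) (e t))"
  define y where "y = (\<lambda>t. matrix_unit n E (if t = 0 then 0 else ci t)
    (if t < k then ri (Suc t) else 0) \<one>\<^bsub>E\<^esub>)"
  have x_closed: "x t \<in> carrier A" if "t \<in> {1..k}" for t
    unfolding x_def A_def using that by (intro E.matrix_unit_closed e_closed)
  have y_closed: "y t \<in> carrier A" for t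
    unfolding y_def A_def by (intro E.matrix_unit_closed) simp
  have alt: "P p k \<in> carrier E \<and> alternating_product A k (x \<circ> p) y =
      matrix_unit n E 0 0 (if \<forall>s\<in>{1..k}. c (p s) = c s then P p k else \<zero>\<^bsub>E\<^esub>)"
    if p: "p permutes {1..k}" for p
    using E.alternating_product_matrix_units[of n k ri ci p e "P p" k] \<open>n \<ge> 1\<close> bnd p e_closed P0
      PSuc[OF p] unfolding x_def y_def A_def type_eq by simp
  have alt_closed: "alternating_product A k (x \<circ> p) y \<in> carrier A" if "p permutes {1..k}" for p
    using alt[OF that] by (auto simp: A_def intro!: E.matrix_unit_closed)
  \<comment> \<open>A permutation that does not respect the matrix units gives a zero entry; any
    other gives the product of its generators, on which \<phi> returns the sign of the word.\<close>
  have \<phi>_alt: "[sign p] \<cdot>\<^bsub>R\<^esub> \<phi> (alternating_product A k (x \<circ> p) y $$ (0, 0)) =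
      [(if p \<in> type_preserving c k {} then capelli_weight M k p else 0)] \<cdot>\<^bsub>R\<^esub> \<one>\<^bsub>R\<^esub>"
    if p: "p permutes {1..k}" for p
  proof -
    have "\<phi> (P p k) = [word_sign M (generator_word M p k)] \<cdot>\<^bsub>R\<^esub> \<one>\<^bsub>R\<^esub>"
      using word[OF p] unfolding P_def by (simp add: \<phi> mono top_coeff_monomial)
    moreover have "[sign p] \<cdot>\<^bsub>R\<^esub> ([z] \<cdot>\<^bsub>R\<^esub> \<one>\<^bsub>R\<^esub>) = [(sign p * z)] \<cdot>\<^bsub>R\<^esub> \<one>\<^bsub>R\<^esub>" for z :: int
      by (simp add: add.int_pow_pow mult.commute)
    ultimately show ?thesis
      using alt[OF p] p \<open>n \<ge> 1\<close>
      by (auto simp: matrix_unit_def type_preserving_def capelli_weight_def \<phi>_zero add_pow_zero)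
  qed

  \<comment> \<open>Evaluation of the Capelli polynomial and divisibility by the
    characteristic\<close>
  have "capelli A k x y = \<zero>\<^bsub>A\<^esub>"
    using sat x_closed y_closed
    unfolding satisfies_capelli_def A_def E_def I_def F_def grassmann_algebra_def
      k_def N_def M_def h_def
    by blast
  \<comment> \<open>Reading off the entry (0, 0) and applying \<phi> is additive, which turns the
    assumed identity into one between integer multiples of the unit of \<open>R\<close>.\<close>
  then have "\<zero>\<^bsub>R\<^esub> = \<phi> (capelli A k x y $$ (0, 0))"
    using \<open>n \<ge> 1\<close> by (simp add: A_def zero_matrix_ring \<phi>_zero)
  also have "\<dots> = (\<Oplus>\<^bsub>R\<^esub>p\<in>{p. p permutes {1..k}}.
      [sign p] \<cdot>\<^bsub>R\<^esub> \<phi> (alternating_product A k (x \<circ> p) y $$ (0, 0)))"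
    unfolding capelli_def
    by (rule abelian_group_hom_signed_finsum[where h = "\<lambda>B. \<phi> (B $$ (0, 0))"])
       (use A.abelian_group_axioms abelian_group_axioms alt_closed \<open>n \<ge> 1\<close> in
         \<open>auto simp: A_def carrier_matrix_ring add_matrix_ring \<phi>_closed \<phi>_add finite_permutations\<close>)
  also have "\<dots> = (\<Oplus>\<^bsub>R\<^esub>p\<in>{p. p permutes {1..k}}.
      [(if p \<in> type_preserving c k {} then capelli_weight M k p else 0)] \<cdot>\<^bsub>R\<^esub> \<one>\<^bsub>R\<^esub>)"
    by (rule finsum_cong') (auto simp: \<phi>_alt)
  also have "\<dots> = [(\<Sum>p | p permutes {1..k}.
      if p \<in> type_preserving c k {} then capelli_weight M k p else 0)] \<cdot>\<^bsub>R\<^esub> \<one>\<^bsub>R\<^esub>"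
    by (rule finsum_int_pow) (auto simp: finite_permutations)
  also have "(\<Sum>p | p permutes {1..k}.
      if p \<in> type_preserving c k {} then capelli_weight M k p else 0) =
      sum (capelli_weight M k) (type_preserving c k {})"
    by (rule sum.mono_neutral_cong_right) (auto simp: finite_permutations type_preserving_def)
  also have "\<dots> = int (\<Prod>b\<in>c ` {1..M}. fact (card {s \<in> {1..M}. c s = b}))"
    unfolding c_def by (rule sum_capelli_weight[OF N0 M_def k_def])
  \<comment> \<open>An integer multiple of the unit vanishes exactly when the additive order of the
    unit divides the integer.\<close>
  finally have "int (ring_char R) dvd int (\<Prod>b\<in>c ` {1..M}. fact (card {s \<in> {1..M}. c s = b}))"
    unfolding ring_char_def by (subst add.int_pow_eq_id[symmetric]) auto
  then have dvd: "ring_char R dvd (\<Prod>b\<in>c ` {1..M}. fact (card {s \<in> {1..M}. c s = b}))"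
    by (simp only: int_dvd_int_iff)
  from assms(3) show False
  proof
    \<comment> \<open>Divisibility by 0 would make a product of factorials zero.\<close>
    assume "ring_char R = 0"
    then show False using dvd by simp
  next
    \<comment> \<open>A prime dividing the product divides the factorial of some block size, so it
      is at most that size, against the assumed bound.\<close>
    assume p: "prime (ring_char R) \<and> 2 * \<lceil>real (m div 2) / real (n\<^sup>2)\<rceil> < int (ring_char R)"
    then obtain b where "ring_char R dvd fact (card {s \<in> {1..M}. c s = b})"
      using dvd by (auto simp: prime_dvd_prod_iff)
    then have "ring_char R \<le> card {s \<in> {1..M}. c s = b}"
      using p by (simp add: prime_dvd_fact_iff)
    also have "\<dots> \<le> nat (2 * \<lceil>real h / real N\<rceil>)"
      unfolding c_def by (rule card_type_block[OF N0 M_def k_def])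
    finally have "ring_char R \<le> nat (2 * \<lceil>real h / real N\<rceil>)" .
    then show False
      using conjunct2[OF p] prime_gt_0_nat[OF conjunct1[OF p]] unfolding h_def N_def by linarith
  qed
qed

end
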